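(* Let $G$ be a finite group of order at least $3$, let $\Gamma_G$ be its power graph and let $M_G$ be the set of maximal involutions of $G$. Then $$\mathrm{rc}(\Gamma_G)=\begin{cases}3, & \text{if } 1\le |M_G|\le 2,\\ |M_G|, & \text{if } |M_G|\ge 3.\end{cases}$$
   Context: For a finite group $G$ with identity $e$, the power graph $\Gamma_G$ is the undirected graph with vertex set $G$ in which two distinct elements are adjacent if one is a power of the other. An involution is an element of order $2$. An involution $x$ is maximal if the only cyclic subgroup of $G$ containing $x$ is $\langle x\rangle$; $M_G$ denotes the set of maximal involutions of $G$. For a connected graph $\Gamma$, an edge coloring $\zeta:E(\Gamma)\to\{1,\dots,k\}$ (adjacent edges may receive the same color) is a rainbow $k$-coloring if every pair of vertices is joined by a path whose edges have pairwise distinct colors; the rainbow connection number $\mathrm{rc}(\Gamma)$ is the minimum $k$ for which a rainbow $k$-coloring exists. *)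

theory Defs
  imports
    "HOL-Algebra.Elementary_Groups"
    "HOL-Algebra.Multiplicative_Group"
    "Graph_Theory.Graph_Theory"
begin

definition power_graph :: "('a, 'b) monoid_scheme \<Rightarrow> 'a pair_pre_digraph" where
  "power_graph G =
     \<lparr> pverts = carrier G,
       parcs = {(x, y). x \<in> carrier G \<and> y \<in> carrier G \<and> x \<noteq> y \<and>
                  ((\<exists>k::int. x = y [^]\<^bsub>G\<^esub> k) \<or> (\<exists>k::int. y = x [^]\<^bsub>G\<^esub> k))} \<rparr>"

definition involution :: "('a, 'b) monoid_scheme \<Rightarrow> 'a \<Rightarrow> bool" where
  "involution G x \<longleftrightarrow> x \<in> carrier G \<and> group.ord G x = 2"

definition maximal_involutions :: "('a, 'b) monoid_scheme \<Rightarrow> 'a set" where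
  "maximal_involutions G =
     {x. involution G x \<and>
         (\<forall>H. subgroup H G \<and> cyclic_group (G\<lparr>carrier := H\<rparr>) \<and> x \<in> H
              \<longrightarrow> H = generate G {x})}"

text \<open>
  An undirected graph is a symmetric digraph, and an undirected edge is the two-element set
  of its ends. Colourings are defined on these sets, so that both orientations
  of an edge carry the same colour.
\<close>

definition uedges :: "('a, 'b) pre_digraph \<Rightarrow> 'a set set" where
  "uedges \<Gamma> = {{u, v} |u v. (u, v) \<in> arcs_ends \<Gamma>}"

definition rainbow_path :: "('a, 'b) pre_digraph \<Rightarrow> ('a set \<Rightarrow> nat) \<Rightarrow> 'a vwalk \<Rightarrow> bool" where
  "rainbow_path \<Gamma> \<zeta> p \<longleftrightarrow> vpath p \<Gamma> \<and> distinct (map (\<lambda>(u, v). \<zeta> {u, v}) (vwalk_arcs p))"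

definition rainbow_coloring :: "('a, 'b) pre_digraph \<Rightarrow> nat \<Rightarrow> ('a set \<Rightarrow> nat) \<Rightarrow> bool" where
  "rainbow_coloring \<Gamma> k \<zeta> \<longleftrightarrow>
     \<zeta> ` uedges \<Gamma> \<subseteq> {1..k} \<and>
     (\<forall>u\<in>verts \<Gamma>. \<forall>v\<in>verts \<Gamma>. \<exists>p. rainbow_path \<Gamma> \<zeta> p \<and> hd p = u \<and> last p = v)"

text \<open>
  Meaningful for finite connected graphs only, where some rainbow colouring exists
  (give all edges different colours); otherwise the value is unspecified.
\<close>

definition rc :: "('a, 'b) pre_digraph \<Rightarrow> nat" where
  "rc \<Gamma> = (LEAST k. \<exists>\<zeta>. rainbow_coloring \<Gamma> k \<zeta>)"

lemma pair_graph_power_graph: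
  assumes "finite (carrier G)"
  shows "pair_graph (power_graph G)"
proof
  show "finite (parcs (power_graph G))"
    by (rule finite_subset[of _ "carrier G \<times> carrier G"]) (auto simp: power_graph_def assms)
qed (auto simp: power_graph_def assms symmetric_def sym_def)

lemma connected_power_graph:
  assumes "group G"
  shows "connected (with_proj (power_graph G))"
proof -
  interpret group G by fact
  let ?S = "with_proj (mk_symmetric (with_proj (power_graph G)))"
  interpret P: wf_digraph ?S
    by unfold_locales (auto simp: mk_symmetric_def power_graph_def)
  have verts: "verts ?S = carrier G"
    by (simp add: mk_symmetric_def power_graph_def)
  have to_one: "x \<rightarrow>\<^sup>*\<^bsub>?S\<^esub> \<one>\<^bsub>G\<^esub>" "\<one>\<^bsub>G\<^esub> \<rightarrow>\<^sup>*\<^bsub>?S\<^esub> x"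
    if x: "x \<in> carrier G" for x
  proof -
    have "x \<rightarrow>\<^sup>*\<^bsub>?S\<^esub> \<one>\<^bsub>G\<^esub> \<and> \<one>\<^bsub>G\<^esub> \<rightarrow>\<^sup>*\<^bsub>?S\<^esub> x"
    proof (cases "x = \<one>\<^bsub>G\<^esub>")
      case True
      then show ?thesis
        using P.reachable_refl[of "\<one>\<^bsub>G\<^esub>"] unfolding verts by simp
    next
      case False
      have "\<exists>k::int. \<one>\<^bsub>G\<^esub> = x [^]\<^bsub>G\<^esub> k"
        by (rule exI[of _ 0]) simp
      then have "(x, \<one>\<^bsub>G\<^esub>) \<in> parcs (power_graph G)"
        using x False unfolding power_graph_def by auto
      then have "(x, \<one>\<^bsub>G\<^esub>) \<in> arcs_ends ?S" "(\<one>\<^bsub>G\<^esub>, x) \<in> arcs_ends ?S"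
        unfolding with_proj_simps mk_symmetric_def pair_pre_digraph.simps
        by (auto intro: bexI[of _ "(x, \<one>\<^bsub>G\<^esub>)"])
      then show ?thesis
        by (intro conjI P.reachable_adjI)
    qed
    then show "x \<rightarrow>\<^sup>*\<^bsub>?S\<^esub> \<one>\<^bsub>G\<^esub>" "\<one>\<^bsub>G\<^esub> \<rightarrow>\<^sup>*\<^bsub>?S\<^esub> x"
      by simp_all
  qed
  show ?thesis
    unfolding connected_def strongly_connected_def verts
    using P.reachable_trans[OF to_one] one_closed by (metis empty_iff)
qed

end

theory Submission
  imports Defs
begin

text \<open>
  A maximal involution is adjacent to the identity only, so a rainbow path between two of them
  is the path through the identity, and the edges from the identity to the maximal involutions
  have pairwise different colours. If there are one or two of them, two colours do not suffice:
  the edge from the identity to \<open>y\<close> must differ in colour from the edges at the maximal involutions.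
  If there are two, \<open>x\<close> and \<open>x'\<close>, take \<open>y = x x'\<close>. If there is only one, \<open>x\<close>, then \<open>x\<close> is central and
  there is another involution \<open>t\<close>, and the only short path from \<open>t\<close> to \<open>x t\<close> passes through the
  identity along two edges of the same colour.

  Conversely, colour the edges from the identity to maximal involutions injectively, those to the
  other involutions with \<open>3\<close>, and those to \<open>y\<close> and to the inverse of \<open>y\<close> with \<open>1\<close> and \<open>2\<close>, for each
  \<open>y\<close> of order at least \<open>3\<close>. An edge between an involution and such a \<open>y\<close> receives the colour of the
  edge from the identity to the inverse of \<open>y\<close>, and every other edge receives \<open>3\<close>.
\<close>

section \<open>Rainbow paths in an arbitrary digraph\<close>

lemma last_arc_in_vwalk_arcs:
  assumes "p \<noteq> []" "hd p \<noteq> last p"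
  shows "\<exists>z. (z, last p) \<in> set (vwalk_arcs p)"
proof -
  obtain q a where "p = q @ [a]" using assms(1) by (metis rev_exhaust)
  with assms have "q \<noteq> []" by auto
  with \<open>p = q @ [a]\<close> show ?thesis by (auto simp: set_vwalk_arcs_snoc)
qed

lemma first_arc_in_vwalk_arcs:
  assumes "p \<noteq> []" "hd p \<noteq> last p"
  shows "\<exists>z. (hd p, z) \<in> set (vwalk_arcs p)"
  using assms by (cases p rule: vwalk_arcs.cases) auto

lemma arc_in_uedges: "(u, v) \<in> arcs_ends \<Gamma> \<Longrightarrow> {u, v} \<in> uedges \<Gamma>"
  by (auto simp: uedges_def)

text \<open>Every rainbow path from \<open>u\<close> to \<open>v\<close> starts with the arc
  \<open>(u, c)\<close> and ends with \<open>(c, v)\<close>. These are different arcs because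
  \<open>u\<close> is not \<open>c\<close>, so their colours differ.\<close>

lemma rainbow_coloring_pendant_edges_distinct:
  assumes col: "rainbow_coloring \<Gamma> k \<zeta>"
    and "u \<in> verts \<Gamma>" "v \<in> verts \<Gamma>" "u \<noteq> v" "u \<noteq> c"
    and u: "\<And>z. (u, z) \<in> arcs_ends \<Gamma> \<Longrightarrow> z = c"
    and v: "\<And>z. (z, v) \<in> arcs_ends \<Gamma> \<Longrightarrow> z = c"
  shows "\<zeta> {u, c} \<noteq> \<zeta> {c, v}"
proof -
  obtain p where p: "rainbow_path \<Gamma> \<zeta> p" "hd p = u" "last p = v"
    using assms unfolding rainbow_coloring_def by blast
  have arcs: "set (vwalk_arcs p) \<subseteq> arcs_ends \<Gamma>" and ne: "p \<noteq> []"
    and inj: "inj_on (\<lambda>(u, v). \<zeta> {u, v}) (set (vwalk_arcs p))"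
    using p by (auto simp: rainbow_path_def vpath_def vwalk_def distinct_map)
  obtain z z' where "(u, z) \<in> set (vwalk_arcs p)" "(z', v) \<in> set (vwalk_arcs p)"
    using first_arc_in_vwalk_arcs last_arc_in_vwalk_arcs ne p \<open>u \<noteq> v\<close> by metis
  then have "(u, c) \<in> set (vwalk_arcs p)" "(c, v) \<in> set (vwalk_arcs p)"
    using arcs u v by blast+
  then show ?thesis using inj \<open>u \<noteq> c\<close> by (force simp: inj_on_def)
qed

text \<open>A rainbow path has at most as many edges as there are colours, here two; distinct
  nonadjacent ends exclude fewer than two.\<close>

lemma rainbow_coloring_two_colors:
  assumes col: "rainbow_coloring \<Gamma> k \<zeta>" and "k \<le> 2"
    and "u \<in> verts \<Gamma>" "v \<in> verts \<Gamma>" "u \<noteq> v" "(u, v) \<notin> arcs_ends \<Gamma>"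
  obtains w where "(u, w) \<in> arcs_ends \<Gamma>" "(w, v) \<in> arcs_ends \<Gamma>" "\<zeta> {u, w} \<noteq> \<zeta> {w, v}"
proof -
  obtain p where p: "rainbow_path \<Gamma> \<zeta> p" "hd p = u" "last p = v"
    using assms unfolding rainbow_coloring_def by blast
  let ?cs = "map (\<lambda>(u, v). \<zeta> {u, v}) (vwalk_arcs p)"
  have arcs: "set (vwalk_arcs p) \<subseteq> arcs_ends \<Gamma>" and ne: "p \<noteq> []" and dist: "distinct ?cs"
    using p by (auto simp: rainbow_path_def vpath_def vwalk_def)
  have "\<zeta> {a, b} \<in> {1..k}" if "(a, b) \<in> set (vwalk_arcs p)" for a b
    using that arcs col arc_in_uedges[of a b \<Gamma>] unfolding rainbow_coloring_def by blast
  then have "set ?cs \<subseteq> {1..k}" by auto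
  then have "length ?cs \<le> k"
    using card_mono[of "{1..k}" "set ?cs"] distinct_card[OF dist] by simp
  then have len: "length (vwalk_arcs p) \<le> 2" using \<open>k \<le> 2\<close> by simp
  obtain a q where q: "p = a # q" using ne by (cases p) auto
  obtain b r where r: "q = b # r" using q p \<open>u \<noteq> v\<close> by (cases q) auto
  obtain c s where s: "r = c # s" using q r p arcs assms(6) by (cases r) auto
  have "s = []" using len q r s by (cases s) auto
  then show thesis using that[of b] q r s p arcs dist by auto
qed

section \<open>Self-inverse elements and maximal involutions\<close>

context group
begin

lemma square_eq_one_iff: "x \<in> carrier G \<Longrightarrow> x \<otimes> x = \<one> \<longleftrightarrow> inv x = x"
  using inv_equality r_inv by fastforce

lemma involution_iff: "involution G x \<longleftrightarrow> x \<in> carrier G \<and> x \<noteq> \<one> \<and> inv x = x"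
proof (cases "x \<in> carrier G")
  case True
  have two: "n dvd 2 \<longleftrightarrow> n = 1 \<or> n = 2" for n :: nat
    using dvd_imp_le[of n 2] by (cases "n = 0") (auto simp: le_Suc_eq numeral_2_eq_2)
  have "ord x = 2 \<longleftrightarrow> x [^] (2::nat) = \<one> \<and> x \<noteq> \<one>"
    using pow_eq_id[OF True, of 2] ord_eq_1[OF True] two by auto
  also have "x [^] (2::nat) = x \<otimes> x" using True by (simp add: numeral_2_eq_2)
  finally show ?thesis using True square_eq_one_iff unfolding involution_def by auto
qed (simp add: involution_def)

lemma int_pow_self_inverse:
  assumes "x \<in> carrier G" "inv x = x"
  shows "x [^] (k::int) \<in> {\<one>, x}"
proof -
  have sq: "x [^] (2::int) = \<one>"
    using assms square_eq_one_iff int_pow_mult[of x 1 1] by simp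
  have "x [^] k = (x [^] (2::int)) [^] (k div 2) \<otimes> x [^] (k mod 2)"
    using assms(1) by (simp add: int_pow_pow int_pow_mult[symmetric])
  then have "x [^] k = x [^] (k mod 2)"
    using assms(1) sq by simp
  moreover have "k mod 2 = 0 \<or> k mod 2 = 1" by auto
  ultimately show ?thesis using assms(1) by auto
qed

lemma generate_self_inverse:
  assumes "x \<in> carrier G" "inv x = x"
  shows "generate G {x} = {\<one>, x}"
proof
  show "generate G {x} \<subseteq> {\<one>, x}"
    using assms int_pow_self_inverse by (auto simp: generate_pow)
  show "{\<one>, x} \<subseteq> generate G {x}"
    by (auto intro: generate.intros)
qed

text \<open>Allows the quantifier over cyclic subgroups in \<open>maximal_involutions\<close> to be
  traded for one over generators.\<close>

lemma cyclic_subgroup_iff: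
  "subgroup H G \<and> cyclic_group (G\<lparr>carrier := H\<rparr>) \<longleftrightarrow> (\<exists>y\<in>carrier G. H = generate G {y})"
proof (intro iffI; elim conjE bexE)
  assume H: "subgroup H G" "cyclic_group (G\<lparr>carrier := H\<rparr>)"
  interpret H: group "G\<lparr>carrier := H\<rparr>" using H(1) by (rule subgroup_imp_group)
  obtain y where y: "y \<in> H" "H = range (\<lambda>n::int. y [^]\<^bsub>G\<lparr>carrier := H\<rparr>\<^esub> n)"
    using H(2) by (auto simp: H.cyclic_group)
  have "y \<in> carrier G" using H(1) y(1) subgroup.mem_carrier by metis
  moreover have "H = range (\<lambda>n::int. y [^] n)"
    using y int_pow_consistent[OF H(1) y(1)] by simp
  ultimately show "\<exists>y\<in>carrier G. H = generate G {y}"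
    by (auto simp: generate_pow)
next
  fix y assume y: "y \<in> carrier G" "H = generate G {y}"
  then have "subgroup_generated G {y} = G\<lparr>carrier := H\<rparr>"
    by (simp add: subgroup_generated_def)
  then show "subgroup H G \<and> cyclic_group (G\<lparr>carrier := H\<rparr>)"
    using y cyclic_group_generated[of y] generate_is_subgroup by auto
qed

text \<open>If the subgroup generated by \<open>y\<close> contains \<open>x\<close> and equals
  \<open>{\<one>, x}\<close>, then \<open>y\<close> lies in it and is not the identity, so it is
  \<open>x\<close>. Maximality thus becomes a statement about roots: \<open>x\<close> has no root
  except itself.\<close>

lemma maximal_involutions_iff:
  "x \<in> maximal_involutions G \<longleftrightarrow>
     involution G x \<and> (\<forall>y\<in>carrier G. \<forall>k::int. x = y [^] k \<longrightarrow> y = x)"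
proof -
  have "(\<forall>H. subgroup H G \<and> cyclic_group (G\<lparr>carrier := H\<rparr>) \<and> x \<in> H \<longrightarrow> H = generate G {x})
      \<longleftrightarrow> (\<forall>y\<in>carrier G. x \<in> generate G {y} \<longrightarrow> generate G {y} = {\<one>, x})"
    if "involution G x"
    using that unfolding conj_assoc[symmetric] cyclic_subgroup_iff
    by (auto simp: generate_self_inverse involution_iff)
  also have "\<dots> \<longleftrightarrow> (\<forall>y\<in>carrier G. x \<in> generate G {y} \<longrightarrow> y = x)"
    if x: "involution G x"
  proof (intro ball_cong refl imp_cong iffI)
    fix y assume y: "y \<in> carrier G" "x \<in> generate G {y}"
    {
      assume "generate G {y} = {\<one>, x}"
      then have "y \<in> {\<one>, x}" using generate.incl[of y "{y}" G] by auto
      moreover have "y \<noteq> \<one>" using y x by (auto simp: generate_one involution_iff)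
      ultimately show "y = x" by auto
    next
      assume "y = x"
      then show "generate G {y} = {\<one>, x}"
        using x generate_self_inverse by (simp add: involution_iff)
    }
  qed
  finally show ?thesis
    unfolding maximal_involutions_def by (auto simp: generate_pow)
qed

lemma maximal_involutionD:
  assumes "x \<in> maximal_involutions G"
  shows "x \<in> carrier G" "x \<noteq> \<one>" "inv x = x"
    and "\<And>y k. y \<in> carrier G \<Longrightarrow> y [^] (k::int) = x \<Longrightarrow> y = x"
  using assms by (auto simp: maximal_involutions_iff involution_iff)

section \<open>Adjacency in the power graph\<close>

lemma power_graph_verts [simp]: "pverts (power_graph G) = carrier G"
  by (simp add: power_graph_def)

lemma power_graph_arcs_iff:
  "(x, y) \<in> parcs (power_graph G) \<longleftrightarrow> x \<in> carrier G \<and> y \<in> carrier G \<and> x \<noteq> y \<and>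
     ((\<exists>k::int. x = y [^] k) \<or> (\<exists>k::int. y = x [^] k))"
  by (simp add: power_graph_def)

lemma power_graph_arcs_sym:
  "(x, y) \<in> parcs (power_graph G) \<longleftrightarrow> (y, x) \<in> parcs (power_graph G)"
  by (auto simp: power_graph_arcs_iff)

lemma power_graph_arc_one: "x \<in> carrier G \<Longrightarrow> x \<noteq> \<one> \<Longrightarrow> (x, \<one>) \<in> parcs (power_graph G)"
  by (auto simp: power_graph_arcs_iff intro: exI[of _ "0::int"])

lemma power_graph_arc_inv: "x \<in> carrier G \<Longrightarrow> inv x \<noteq> x \<Longrightarrow> (x, inv x) \<in> parcs (power_graph G)"
  using int_pow_neg[of x 1] by (auto simp: power_graph_arcs_iff intro: exI[of _ "-1::int"])

text \<open>The only powers of \<open>x\<close> are the identity and \<open>x\<close>, so adjacency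
  to any other \<open>z\<close> can only come from \<open>x\<close> being a power of
  \<open>z\<close>.\<close>

lemma self_inverse_arc:
  assumes "x \<in> carrier G" "inv x = x" "(x, z) \<in> parcs (power_graph G)" "z \<noteq> \<one>"
  obtains k :: int where "x = z [^] k"
proof -
  have "z \<noteq> x [^] k" for k :: int
    using int_pow_self_inverse[OF assms(1,2), of k] assms(3,4) by (auto simp: power_graph_arcs_iff)
  then show thesis using assms(3) that by (auto simp: power_graph_arcs_iff)
qed

lemma maximal_involution_pendant:
  assumes "x \<in> maximal_involutions G" "(x, z) \<in> parcs (power_graph G)"
  shows "z = \<one>"
proof (rule ccontr)
  assume "z \<noteq> \<one>"
  then obtain k :: int where "x = z [^] k"
    using self_inverse_arc maximal_involutionD(1,3)[OF assms(1)] assms(2) by metis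
  then show False
    using maximal_involutionD(4)[OF assms(1), of z k] assms(2) by (simp add: power_graph_arcs_iff)
qed

lemma maximal_involution_pendant':
  assumes "x \<in> maximal_involutions G" "(z, x) \<in> parcs (power_graph G)"
  shows "z = \<one>"
  using assms maximal_involution_pendant power_graph_arcs_sym by blast

section \<open>Lower bounds for the number of colours\<close>

lemma rainbow_coloring_inj_on_maximal_involutions:
  assumes "rainbow_coloring (with_proj (power_graph G)) k \<zeta>"
  shows "inj_on (\<lambda>x. \<zeta> {\<one>, x}) (maximal_involutions G)"
proof (rule inj_onI, rule ccontr)
  fix x y assume xy: "x \<in> maximal_involutions G" "y \<in> maximal_involutions G"
    "\<zeta> {\<one>, x} = \<zeta> {\<one>, y}" "x \<noteq> y"
  have "\<zeta> {x, \<one>} \<noteq> \<zeta> {\<one>, y}"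
    by (rule rainbow_coloring_pendant_edges_distinct[OF assms])
       (simp_all add: xy maximal_involutionD(1,2)
          maximal_involution_pendant[OF xy(1)] maximal_involution_pendant'[OF xy(2)])
  then show False using xy by (simp add: insert_commute)
qed

lemma rainbow_coloring_one_edge:
  assumes "rainbow_coloring (with_proj (power_graph G)) k \<zeta>" "x \<in> carrier G" "x \<noteq> \<one>"
  shows "\<zeta> {\<one>, x} \<in> {1..k}"
proof -
  have "{\<one>, x} \<in> uedges (with_proj (power_graph G))"
    using assms power_graph_arc_one power_graph_arcs_sym by (intro arc_in_uedges) simp
  then show ?thesis using assms(1) by (auto simp: rainbow_coloring_def)
qed

lemma card_maximal_involutions_le_colors:
  assumes "rainbow_coloring (with_proj (power_graph G)) k \<zeta>"
  shows "card (maximal_involutions G) \<le> k"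
proof -
  have "(\<lambda>x. \<zeta> {\<one>, x}) ` maximal_involutions G \<subseteq> {1..k}"
    using rainbow_coloring_one_edge[OF assms] maximal_involutionD by blast
  then have "card (maximal_involutions G) \<le> card {1..k}"
    by (intro card_inj_on_le[OF rainbow_coloring_inj_on_maximal_involutions[OF assms]]) auto
  then show ?thesis by simp
qed

text \<open>As \<open>x\<close> has the identity as its only neighbour, the two-edge path from
  \<open>x\<close> to \<open>y\<close> has the identity as its midpoint.\<close>

lemma two_colors_maximal_involution:
  assumes "rainbow_coloring (with_proj (power_graph G)) k \<zeta>" "k \<le> 2"
    and x: "x \<in> maximal_involutions G" and y: "y \<in> carrier G" "y \<noteq> \<one>" "y \<noteq> x"
  shows "\<zeta> {\<one>, x} \<noteq> \<zeta> {\<one>, y}"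
proof -
  obtain w where "(x, w) \<in> parcs (power_graph G)" "\<zeta> {x, w} \<noteq> \<zeta> {w, y}"
    using rainbow_coloring_two_colors[OF assms(1,2), of x y]
      maximal_involutionD[OF x] maximal_involution_pendant[OF x] y
    by (metis power_graph_verts with_proj_simps(1,3))
  then show ?thesis using maximal_involution_pendant[OF x] by (auto simp: insert_commute)
qed

lemma two_maximal_involutions_need_three_colors:
  assumes "x \<in> maximal_involutions G" "x' \<in> maximal_involutions G" "x \<noteq> x'"
    and col: "rainbow_coloring (with_proj (power_graph G)) k \<zeta>"
  shows "3 \<le> k"
proof (rule ccontr)
  assume "\<not> 3 \<le> k"
  then have k: "k \<le> 2" by simp
  note x = maximal_involutionD(1-3)[OF assms(1)] and x' = maximal_involutionD(1-3)[OF assms(2)]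
  let ?y = "x \<otimes> x'"
  have y: "?y \<in> carrier G" "?y \<noteq> \<one>" "?y \<noteq> x" "?y \<noteq> x'"
    \<comment> \<open>A trivial product would make one factor the inverse of the other, hence equal
      to it.\<close>
    using x x' \<open>x \<noteq> x'\<close> by (auto dest: inv_equality)
  have "\<zeta> {\<one>, x} \<noteq> \<zeta> {\<one>, ?y}" "\<zeta> {\<one>, x'} \<noteq> \<zeta> {\<one>, ?y}" "\<zeta> {\<one>, x} \<noteq> \<zeta> {\<one>, x'}"
    using two_colors_maximal_involution[OF col k] assms x x' y by metis+
  moreover have "\<zeta> {\<one>, x} \<in> {1..k}" "\<zeta> {\<one>, x'} \<in> {1..k}" "\<zeta> {\<one>, ?y} \<in> {1..k}"
    using rainbow_coloring_one_edge[OF col] x x' y by auto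
  ultimately show False using k by auto
qed

lemma conjugate_int_pow:
  assumes "g \<in> carrier G" "y \<in> carrier G"
  shows "(inv g \<otimes> y \<otimes> g) [^] (k::int) = inv g \<otimes> y [^] k \<otimes> g"
proof -
  \<comment> \<open>This cancellation is what makes conjugation multiplicative.\<close>
  have "g \<otimes> (inv g \<otimes> z) = z" if "z \<in> carrier G" for z
    using that assms(1) by (simp add: m_assoc[symmetric])
  then interpret h: group_hom G G "\<lambda>y. inv g \<otimes> y \<otimes> g"
    using assms(1) by unfold_locales (auto simp: hom_def m_assoc)
  show ?thesis using h.hom_int_pow[OF assms(2)] by simp
qed

text \<open>Conjugating back by \<open>g\<close> turns a root of the conjugate into a root of
  \<open>x\<close>, and the only root of \<open>x\<close> is \<open>x\<close>.\<close>

lemma conjugate_maximal_involution: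
  assumes "x \<in> maximal_involutions G" "g \<in> carrier G"
  shows "g \<otimes> x \<otimes> inv g \<in> maximal_involutions G"
proof -
  note x = maximal_involutionD[OF assms(1)]
  have cancel: "inv g \<otimes> (g \<otimes> a \<otimes> inv g) \<otimes> g = a" "g \<otimes> (inv g \<otimes> a \<otimes> g) \<otimes> inv g = a"
    if "a \<in> carrier G" for a
    using that assms(2) by (simp_all add: m_assoc) (simp_all add: m_assoc[symmetric])
  have "g \<otimes> x \<otimes> inv g \<noteq> \<one>"
  proof
    assume "g \<otimes> x \<otimes> inv g = \<one>"
    then show False using cancel(1)[OF x(1)] x(2) assms(2) by simp
  qed
  moreover have "inv (g \<otimes> x \<otimes> inv g) = g \<otimes> x \<otimes> inv g"
    using x assms(2) by (simp add: inv_mult_group m_assoc)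
  moreover have "y = g \<otimes> x \<otimes> inv g" if y: "y \<in> carrier G" "g \<otimes> x \<otimes> inv g = y [^] k" for y and k :: int
  proof -
    have "(inv g \<otimes> y \<otimes> g) [^] k = x"
      using conjugate_int_pow[OF assms(2) y(1), of k] y(2)[symmetric] cancel(1)[of x] x(1) by simp
    then have "inv g \<otimes> y \<otimes> g = x" using x(4)[of "inv g \<otimes> y \<otimes> g" k] y(1) assms(2) by simp
    then show ?thesis using cancel(2)[OF y(1)] by simp
  qed
  ultimately show ?thesis
    using x(1) assms(2) unfolding maximal_involutions_iff involution_iff by blast
qed

lemma unique_maximal_involution_central:
  assumes "maximal_involutions G = {x}" "g \<in> carrier G"
  shows "g \<otimes> x = x \<otimes> g"
proof -
  have "x \<in> carrier G" using assms(1) maximal_involutionD(1) by blast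
  moreover have "g \<otimes> x \<otimes> inv g = x"
    using conjugate_maximal_involution[of x g] assms by simp
  ultimately show ?thesis using assms(2) by (metis inv_solve_right m_closed)
qed

text \<open>Take \<open>y\<close> outside \<open>{\<one>, x}\<close>. If its order \<open>n\<close>
  is even, the power of \<open>y\<close> with exponent \<open>n div 2\<close> is an involution, and
  not \<open>x\<close> since \<open>x\<close> has no other root. If \<open>n\<close> is odd,
  \<open>x\<close> is central, so the \<open>n\<close>-th power of \<open>x \<otimes> y\<close> is
  \<open>x\<close>; this makes \<open>x \<otimes> y\<close> a root of \<open>x\<close> different
  from \<open>x\<close>, which is impossible.\<close>

lemma another_involution:
  assumes "finite (carrier G)" "order G \<ge> 3" "maximal_involutions G = {x}"
  obtains t where "involution G t" "t \<noteq> x"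
proof -
  have xM: "x \<in> maximal_involutions G" using assms(3) by simp
  note x = maximal_involutionD[OF xM]
  have "\<not> carrier G \<subseteq> {\<one>, x}"
    using assms(2) card_mono[of "{\<one>, x}" "carrier G"] card_insert_le_m1[of 2 "{x}" \<one>]
    by (auto simp: order_def)
  then obtain y where y: "y \<in> carrier G" "y \<noteq> \<one>" "y \<noteq> x" by auto
  let ?n = "ord y"
  have n: "?n > 0" using ord_ge_1[OF assms(1) y(1)] by simp
  show thesis
  proof (cases "even ?n")
    case True
    let ?t = "y [^] (?n div 2)"
    \<comment> \<open>The exponent is positive and smaller than the order of \<open>y\<close>, so
      the order does not divide it.\<close>
    have "?t \<noteq> \<one>" using y(1) n True pow_eq_id[OF y(1), of "?n div 2"] by (auto dest: dvd_imp_le)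
    moreover have "?t \<otimes> ?t = \<one>"
      using y(1) True nat_pow_mult[OF y(1), of "?n div 2" "?n div 2"]
      by (auto simp flip: mult_2)
    moreover have "?t \<noteq> x" using x(4)[OF y(1), of "int (?n div 2)"] y(3) unfolding int_pow_int by blast
    ultimately show thesis
      using that[of ?t] y(1) square_eq_one_iff[of ?t] by (auto simp: involution_iff)
  next
    case False
    have "(x \<otimes> y) [^] ?n = x [^] ?n \<otimes> y [^] ?n"
      using unique_maximal_involution_central[OF assms(3) y(1)] x(1) y(1)
      by (intro pow_mult_distrib) auto
    also have "\<dots> = x [^] ?n" using x(1) y(1) by simp
    also have "x [^] ?n = x"
    proof -
      obtain m where m: "?n = Suc (2 * m)" using False by (metis oddE Suc_eq_plus1)
      have "x [^] (2 * m) = (x [^] (2::nat)) [^] m" using x(1) by (simp add: nat_pow_pow)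
      also have "x [^] (2::nat) = \<one>"
        using x(1,3) square_eq_one_iff[of x] by (simp add: numeral_2_eq_2)
      finally show ?thesis using x(1) m by simp
    qed
    finally have "(x \<otimes> y) [^] int ?n = x" by (simp only: int_pow_int)
    then have "x \<otimes> y = x" using x(4) x(1) y(1) by blast
    then have False using x(1) y by simp
    then show thesis ..
  qed
qed

lemma unique_maximal_involution_needs_three_colors:
  assumes "finite (carrier G)" "order G \<ge> 3" and M: "maximal_involutions G = {x}"
    and col: "rainbow_coloring (with_proj (power_graph G)) k \<zeta>"
  shows "3 \<le> k"
proof (rule ccontr)
  assume "\<not> 3 \<le> k"
  then have k: "k \<le> 2" by simp
  have xM: "x \<in> maximal_involutions G" using M by simp
  note x = maximal_involutionD[OF xM]
  obtain t where t: "involution G t" "t \<noteq> x" using another_involution assms by metis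
  then have tc: "t \<in> carrier G" "t \<noteq> \<one>" "inv t = t" by (auto simp: involution_iff)
  let ?s = "x \<otimes> t"
  have s: "?s \<in> carrier G" "?s \<noteq> \<one>" "?s \<noteq> x" "?s \<noteq> t"
    using x(1-3) tc t by (auto dest: inv_equality)
  have s_inv: "inv ?s = ?s"
    using x(1-3) tc unique_maximal_involution_central[OF M tc(1)] by (simp add: inv_mult_group)
  \<comment> \<open>A common root of \<open>?s\<close> and \<open>t\<close> is also a root of their
    quotient \<open>x\<close>, hence equal to \<open>x\<close>.\<close>
  have "?s \<otimes> inv t = x" 
    using x(1) tc square_eq_one_iff[of t] by (simp add: m_assoc)
  then have no_root: "w \<in> {\<one>, x}" if "w \<in> carrier G" "?s = w [^] a" "t = w [^] b" for w and a b :: int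
    using that x(4)[of w "a - b"] by (simp add: int_pow_diff)
  \<comment> \<open>Adjacency would make \<open>t\<close> a power of the self-inverse
    \<open>?s\<close>, that is, the identity or \<open>?s\<close>.\<close>
  have nadj: "(t, ?s) \<notin> parcs (power_graph G)"
    using self_inverse_arc[OF tc(1,3) _ s(2)] int_pow_self_inverse[OF s(1) s_inv] s(4) tc(2)
    by (metis insertE singletonD)
  obtain w where w: "(t, w) \<in> parcs (power_graph G)" "(w, ?s) \<in> parcs (power_graph G)"
    "\<zeta> {t, w} \<noteq> \<zeta> {w, ?s}"
    using rainbow_coloring_two_colors[OF col k, of t ?s] tc s nadj by auto
  have "w = \<one>"
  proof (rule ccontr)
    assume "w \<noteq> \<one>"
    moreover have "(?s, w) \<in> parcs (power_graph G)" using w(2) power_graph_arcs_sym by blast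
    ultimately obtain a b :: int where "?s = w [^] a" "t = w [^] b"
      using self_inverse_arc[OF tc(1,3) w(1)] self_inverse_arc[OF s(1) s_inv] by metis
    then have "w = x" using no_root \<open>w \<noteq> \<one>\<close> w(1) by (auto simp: power_graph_arcs_iff)
    then show False using maximal_involution_pendant'[OF xM] w(1) tc(2) by simp
  qed
  \<comment> \<open>Both edges of the path avoid the colour of the edge to \<open>x\<close>, which
    leaves them a single colour.\<close>
  moreover have "\<zeta> {\<one>, t} \<noteq> \<zeta> {\<one>, x}" "\<zeta> {\<one>, ?s} \<noteq> \<zeta> {\<one>, x}"
    using two_colors_maximal_involution[OF col k xM] tc s t by metis+
  moreover have "\<zeta> {\<one>, t} \<in> {1..k}" "\<zeta> {\<one>, ?s} \<in> {1..k}" "\<zeta> {\<one>, x} \<in> {1..k}"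
    using rainbow_coloring_one_edge[OF col] tc(1,2) s(1,2) x(1,2) by blast+
  ultimately show False using w(3) k by (auto simp: insert_commute)
qed

section \<open>Construction of the colouring\<close>

lemma nonmaximal_involution_root:
  assumes "involution G t" "t \<notin> maximal_involutions G"
  obtains w where "w \<in> carrier G" "inv w \<noteq> w" "(t, w) \<in> parcs (power_graph G)"
proof -
  obtain w and k :: int where w: "w \<in> carrier G" "t = w [^] k" "w \<noteq> t"
    using assms by (auto simp: maximal_involutions_iff)
  \<comment> \<open>A self-inverse \<open>w\<close> has only the identity and itself as powers, and
    \<open>t\<close> is neither.\<close>
  moreover have "inv w \<noteq> w"
    using int_pow_self_inverse[OF w(1), of k] w assms(1) by (auto simp: involution_iff)
  ultimately show thesis
    using that[of w] assms(1) by (auto simp: power_graph_arcs_iff involution_iff)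
qed

text \<open>The colour of the edge from the identity to \<open>x\<close>; the value at the identity itself is arbitrary.\<close>

definition edge_label :: "('a \<Rightarrow> nat) \<Rightarrow> 'a \<Rightarrow> nat" where
  "edge_label f x = (if x \<in> maximal_involutions G then f x
     else if inv x = x then 3
     else if x = (SOME z. z \<in> {x, inv x}) then 1 else 2)"

lemma edge_label_inv:
  assumes "x \<in> carrier G" "inv x \<noteq> x"
  shows "{edge_label f x, edge_label f (inv x)} = {1, 2}"
proof -
  have "x \<notin> maximal_involutions G" "inv x \<notin> maximal_involutions G"
    using assms maximal_involutionD(3)[of x] maximal_involutionD(3)[of "inv x"] by auto
  moreover have "(SOME z. z \<in> {x, inv x}) \<in> {x, inv x}" by (rule someI[of _ x]) simp
  \<comment> \<open>The choice in \<open>edge_label\<close> depends on the unordered pair only, so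
    \<open>x\<close> and \<open>inv x\<close> agree on which of them gets label 1.\<close>
  moreover have "{inv x, x} = {x, inv x}" by auto
  ultimately show ?thesis using assms unfolding edge_label_def by auto
qed

text \<open>A colouring takes an unordered edge, so \<open>THE\<close> recovers the relevant end:
  the one that is not the identity, or the one that is not self-inverse. In the second case the
  label of \<open>inv y\<close> makes the two edges of the path from \<open>t\<close> through
  \<open>y\<close> to the identity receive the colours 1 and 2.\<close>

definition edge_coloring :: "('a \<Rightarrow> nat) \<Rightarrow> 'a set \<Rightarrow> nat" where
  "edge_coloring f S =
     (if \<exists>x. x \<noteq> \<one> \<and> S = {\<one>, x} then edge_label f (THE x. x \<noteq> \<one> \<and> S = {\<one>, x})
      else if \<exists>t y. involution G t \<and> inv y \<noteq> y \<and> S = {t, y}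
        then edge_label f (inv (THE y. inv y \<noteq> y \<and> y \<in> S))
      else 3)"

lemma edge_coloring_one:
  assumes "x \<noteq> \<one>"
  shows "edge_coloring f {\<one>, x} = edge_label f x" "edge_coloring f {x, \<one>} = edge_label f x"
proof -
  have "(THE y. y \<noteq> \<one> \<and> {\<one>, x} = {\<one>, y}) = x"
    using assms by (intro the_equality) (auto simp: doubleton_eq_iff)
  then show "edge_coloring f {\<one>, x} = edge_label f x"
    using assms by (auto simp: edge_coloring_def)
  then show "edge_coloring f {x, \<one>} = edge_label f x" by (simp add: insert_commute)
qed

lemma edge_coloring_involution:
  assumes "involution G t" "inv y \<noteq> y"
  shows "edge_coloring f {t, y} = edge_label f (inv y)"
proof -
  have ty: "t \<noteq> \<one>" "inv t = t" "y \<noteq> \<one>" using assms by (auto simp: involution_iff)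
  then have "(THE z. inv z \<noteq> z \<and> z \<in> {t, y}) = y"
    using assms(2) by (intro the_equality) auto
  then show ?thesis using assms ty unfolding edge_coloring_def by (auto simp: doubleton_eq_iff)
qed

lemma edge_coloring_inv:
  assumes "y \<in> carrier G" "inv y \<noteq> y"
  shows "edge_coloring f {y, inv y} = 3"
proof -
  have "inv y \<noteq> \<one>" "y \<noteq> \<one>" using assms by auto
  then show ?thesis
    using assms by (auto simp: edge_coloring_def doubleton_eq_iff involution_iff)
qed

section \<open>Rainbow paths under this colouring\<close>

abbreviation rainbow_connected :: "('a \<Rightarrow> nat) \<Rightarrow> 'a \<Rightarrow> 'a \<Rightarrow> bool" where
  "rainbow_connected f u v \<equiv>
     \<exists>p. rainbow_path (with_proj (power_graph G)) (edge_coloring f) p \<and> hd p = u \<and> last p = v"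

lemma rainbow_connected_refl: "u \<in> carrier G \<Longrightarrow> rainbow_connected f u u"
  by (intro exI[of _ "[u]"]) (simp add: rainbow_path_def vpath_def vwalk_def)

lemma rainbow_connected_one:
  assumes "u \<in> carrier G" "u \<noteq> \<one>"
  shows "rainbow_connected f u \<one>" "rainbow_connected f \<one> u"
proof -
  have "(u, \<one>) \<in> parcs (power_graph G)" "(\<one>, u) \<in> parcs (power_graph G)"
    using assms power_graph_arc_one power_graph_arcs_sym by blast+
  then have "rainbow_path (with_proj (power_graph G)) (edge_coloring f) p"
    if "p = [u, \<one>] \<or> p = [\<one>, u]" for p
    using that assms by (auto simp: rainbow_path_def vpath_def vwalk_def)
  then show "rainbow_connected f u \<one>" "rainbow_connected f \<one> u"
    by (metis last.simps list.distinct(1) list.sel(1))+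
qed

lemma rainbow_connected_via_one:
  assumes "u \<in> carrier G" "u \<noteq> \<one>" "v \<in> carrier G" "v \<noteq> \<one>" "edge_label f u \<noteq> edge_label f v"
  shows "rainbow_connected f u v"
  using assms power_graph_arc_one power_graph_arcs_sym
  by (intro exI[of _ "[u, \<one>, v]"])
     (auto simp: rainbow_path_def vpath_def vwalk_def edge_coloring_one)

text \<open>The path \<open>[u, w, \<one>, v]\<close> and its reversal carry the three listed
  colours. Having both directions lets later case distinctions ignore the order of the ends.\<close>

lemma rainbow_connected_via_two:
  assumes "u \<in> carrier G" "u \<noteq> \<one>" "v \<in> carrier G" "v \<noteq> \<one>" "w \<noteq> \<one>" "u \<noteq> v" "w \<noteq> v"
    and "(u, w) \<in> parcs (power_graph G)"
    and "distinct [edge_coloring f {u, w}, edge_label f w, edge_label f v]"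
  shows "rainbow_connected f u v" "rainbow_connected f v u"
proof -
  have w: "w \<in> carrier G" "u \<noteq> w" using assms(8) by (auto simp: power_graph_arcs_iff)
  show "rainbow_connected f u v"
    using assms w power_graph_arc_one power_graph_arcs_sym
    by (intro exI[of _ "[u, w, \<one>, v]"])
       (auto simp: rainbow_path_def vpath_def vwalk_def edge_coloring_one)
  have "(w, u) \<in> parcs (power_graph G)" using assms(8) power_graph_arcs_sym by blast
  then show "rainbow_connected f v u"
    using assms w power_graph_arc_one power_graph_arcs_sym
    by (intro exI[of _ "[v, \<one>, w, u]"])
       (auto simp: rainbow_path_def vpath_def vwalk_def edge_coloring_one insert_commute)
qed

text \<open>The detour through \<open>inv u\<close> works: the edge from \<open>u\<close> to
  \<open>inv u\<close> has colour 3, and the edges from the identity to \<open>inv u\<close> and to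
  \<open>v\<close> have the colours 1 and 2 in some order.\<close>

lemma rainbow_connected_same_label:
  assumes u: "u \<in> carrier G" "u \<noteq> \<one>" "inv u \<noteq> u" and v: "v \<in> carrier G" "v \<noteq> \<one>"
    and uv: "u \<noteq> v" "edge_label f u = edge_label f v"
  shows "rainbow_connected f u v" "rainbow_connected f v u"
proof -
  have lab: "{edge_label f u, edge_label f (inv u)} = {1, 2}" using edge_label_inv u by blast
  then have "inv u \<noteq> v" using uv by (auto simp: doubleton_eq_iff)
  moreover have "inv u \<noteq> \<one>" using u by simp
  moreover have "distinct [edge_coloring f {u, inv u}, edge_label f (inv u), edge_label f v]"
    using lab uv edge_coloring_inv[OF u(1,3)] by (auto simp: doubleton_eq_iff)
  ultimately show "rainbow_connected f u v" "rainbow_connected f v u"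
    using rainbow_connected_via_two[of u v "inv u" f] u v uv power_graph_arc_inv by blast+
qed

text \<open>With a root \<open>w\<close> of \<open>t\<close> that is not self-inverse, the path
  through \<open>w\<close> and the identity uses 1 and 2 in some order before the final 3. Here
  \<open>v\<close> may be maximal, as \<open>f\<close> may assign 3 to a maximal involution.\<close>

lemma rainbow_connected_nonmaximal_involution:
  assumes t: "involution G t" "t \<notin> maximal_involutions G"
    and v: "involution G v" "edge_label f v = 3" "t \<noteq> v"
  shows "rainbow_connected f t v" "rainbow_connected f v t"
proof -
  obtain w where w: "w \<in> carrier G" "inv w \<noteq> w" "(t, w) \<in> parcs (power_graph G)"
    using nonmaximal_involution_root[OF t] .
  have "{edge_label f w, edge_label f (inv w)} = {1, 2}" using edge_label_inv w by blast
  then have "distinct [edge_coloring f {t, w}, edge_label f w, edge_label f v]"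
    using edge_coloring_involution[OF t(1) w(2)] v by (auto simp: doubleton_eq_iff)
  moreover have "w \<noteq> \<one>" "w \<noteq> v" using w v by (auto simp: involution_iff)
  ultimately show "rainbow_connected f t v" "rainbow_connected f v t"
    using rainbow_connected_via_two[of t v w f] t v w unfolding involution_iff by blast+
qed

lemma rainbow_connected:
  assumes inj: "inj_on f (maximal_involutions G)"
    and uv: "u \<in> carrier G" "v \<in> carrier G"
  shows "rainbow_connected f u v"
proof -
  consider "u = v" | "u \<noteq> v" "u = \<one> \<or> v = \<one>"
    | "u \<noteq> \<one>" "v \<noteq> \<one>" "edge_label f u \<noteq> edge_label f v"
    | "u \<noteq> v" "u \<noteq> \<one>" "v \<noteq> \<one>" "edge_label f u = edge_label f v" "inv u \<noteq> u \<or> inv v \<noteq> v"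
    | "u \<noteq> v" "edge_label f u = edge_label f v" "involution G u" "involution G v"
    using uv involution_iff by blast
  then show ?thesis
  proof cases
    case 5
    \<comment> \<open>Two distinct maximal involutions have different labels by injectivity of
      \<open>f\<close>; so one end is not maximal, and the common label is 3.\<close>
    then have "u \<notin> maximal_involutions G \<or> v \<notin> maximal_involutions G"
      using inj_onD[OF inj, of u v] 5(1,2) by (auto simp: edge_label_def)
    moreover have "edge_label f t = 3" if "involution G t" "t \<notin> maximal_involutions G" for t
      using that by (simp add: edge_label_def involution_iff)
    ultimately show ?thesis
      using rainbow_connected_nonmaximal_involution 5 by metis
  qed (use uv rainbow_connected_refl rainbow_connected_one rainbow_connected_via_one
         rainbow_connected_same_label in metis)+
qed

section \<open>The rainbow connection number\<close>

lemma rainbow_coloring_exists: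
  assumes "finite (carrier G)" "3 \<le> k" "card (maximal_involutions G) \<le> k"
  shows "\<exists>\<zeta>. rainbow_coloring (with_proj (power_graph G)) k \<zeta>"
proof -
  have "finite (maximal_involutions G)"
    using assms(1) maximal_involutionD(1) finite_subset by (metis subsetI)
  then obtain f where f: "f ` maximal_involutions G \<subseteq> {1..k}" "inj_on f (maximal_involutions G)"
    using card_le_inj[of "maximal_involutions G" "{1..k}"] assms(3) by auto
  then have "edge_label f x \<in> {1..k}" for x
    using assms(2) by (auto simp: edge_label_def)
  \<comment> \<open>The bound holds for every set, edge or not: each value is a label or the default
    3.\<close>
  then have "edge_coloring f S \<in> {1..k}" for S
    using assms(2) by (simp add: edge_coloring_def del: atLeastAtMost_iff) simp
  then show ?thesis
    using rainbow_connected[OF f(2)] unfolding rainbow_coloring_def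
    by (intro exI[of _ "edge_coloring f"] conjI ballI image_subsetI) simp_all
qed

lemma rc_power_graph:
  assumes "finite (carrier G)" "order G \<ge> 3" "maximal_involutions G \<noteq> {}"
  shows "rc (with_proj (power_graph G)) = max 3 (card (maximal_involutions G))"
  unfolding rc_def
proof (rule Least_equality)
  show "\<exists>\<zeta>. rainbow_coloring (with_proj (power_graph G)) (max 3 (card (maximal_involutions G))) \<zeta>"
    using assms(1) by (intro rainbow_coloring_exists) auto
  fix k assume "\<exists>\<zeta>. rainbow_coloring (with_proj (power_graph G)) k \<zeta>"
  then obtain \<zeta> where col: "rainbow_coloring (with_proj (power_graph G)) k \<zeta>" by blast
  have "3 \<le> k"
    using assms unique_maximal_involution_needs_three_colors[OF _ _ _ col]
      two_maximal_involutions_need_three_colors[OF _ _ _ col] by blast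
  then show "max 3 (card (maximal_involutions G)) \<le> k"
    using card_maximal_involutions_le_colors[OF col] by simp
qed

end

theorem theorem2p1:
  fixes G :: "('a, 'b) monoid_scheme"
  assumes "group G"
    and "finite (carrier G)"
    and "order G \<ge> 3"
  shows "(1 \<le> card (maximal_involutions G) \<and> card (maximal_involutions G) \<le> 2
            \<longrightarrow> rc (with_proj (power_graph G)) = 3) \<and>
         (card (maximal_involutions G) \<ge> 3
            \<longrightarrow> rc (with_proj (power_graph G)) = card (maximal_involutions G))"
proof (cases "maximal_involutions G = {}")
  case False
  then show ?thesis using group.rc_power_graph[OF assms False] by auto
\<comment> \<open>Without maximal involutions the cardinality is 0 and both premises fail.\<close>
qed simp

end
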